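(* Let $f\in\mathcal{S}$ be given by $f(z)=z+a_2z^2+a_3z^3+\cdots$ for $|z|<1$. Then $$|a_4|-|a_3|\le 2.1033299\ldots.$$
   Context: Let $\mathbb{D}=\{z\in\mathbb{C}:|z|<1\}$. $\mathcal{S}$ denotes the class of functions $f$ that are analytic and univalent (injective) in $\mathbb{D}$, with power series expansion $f(z)=z+a_2z^2+a_3z^3+\cdots$ (so $f(0)=0$, $f'(0)=1$). *)

theory Defs
  imports "HOL-Complex_Analysis.Complex_Analysis"
begin

definition class_S :: "(complex \<Rightarrow> complex) set" where
  "class_S = {f. f analytic_on ball 0 1 \<and> inj_on f (ball 0 1) \<and> f 0 = 0 \<and> deriv f 0 = 1}"

end

theory Submission
  imports Defs
begin

text \<open>
  The proof rests on Gronwall's area theorem applied to a square-root transform. Write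
  \<open>f(w) = w \<phi>(w)\<close>. As \<open>f\<close> is injective with \<open>f(0) = 0\<close>, \<open>\<phi>\<close> has no zero in the disc, so there is
  a holomorphic \<open>\<psi> = \<phi>\<^sup>-\<^sup>1\<^sup>/\<^sup>2 = 1 + B\<^sub>1 w + B\<^sub>2 w\<^sup>2 + B\<^sub>3 w\<^sup>3 + \<dots>\<close>. The odd function
  \<open>G(z) = \<psi>(z\<^sup>2)/z = 1/z + B\<^sub>1 z + B\<^sub>2 z\<^sup>3 + B\<^sub>3 z\<^sup>5 + \<dots>\<close> satisfies \<open>G(z)\<^sup>2 = 1/f(z\<^sup>2)\<close> and is
  injective on the punctured disc, and the area theorem yields
  \<open>\<bar>B\<^sub>1\<bar>\<^sup>2 + 3\<bar>B\<^sub>2\<bar>\<^sup>2 + 5\<bar>B\<^sub>3\<bar>\<^sup>2 \<le> 1\<close> (\<open>area_theorem_square_root_transform\<close>).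

  Comparing coefficients in \<open>\<psi>\<^sup>2 \<phi> = 1\<close> expresses \<open>a\<^sub>3\<close> and \<open>a\<^sub>4\<close> through the \<open>B\<^sub>i\<close>, and
  \<open>a\<^sub>4 + B\<^sub>1 a\<^sub>3 = 4 B\<^sub>1 B\<^sub>2 - 2 B\<^sub>3 - B\<^sub>1\<^sup>3\<close>. Since \<open>\<bar>B\<^sub>1\<bar> \<le> 1\<close>, the difference
  \<open>\<bar>a\<^sub>4\<bar> - \<bar>a\<^sub>3\<bar>\<close> is at most the modulus of the left-hand side. So it suffices to maximise
  \<open>2u + 4xy + x\<^sup>3\<close> on the ellipsoid \<open>x\<^sup>2 + 3y\<^sup>2 + 5u\<^sup>2 \<le> 1\<close>, and elementary completions of squares
  already bound it by \<open>2.1\<close> (\<open>coefficient_bound_on_ellipsoid\<close>).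

  The area theorem for \<open>G(z) = 1/z + \<Sum> b\<^sub>n z\<^sup>n\<close> is proved by comparing two measures. The area of the
  image of the annulus \<open>\<epsilon> < \<bar>z\<bar> < r\<close> is the integral of \<open>\<bar>G'\<bar>\<^sup>2\<close>; in the coordinate \<open>log z\<close> the
  annulus is a rectangle, so change of variables, Fubini and Bessel's inequality on circles bound
  it below by \<open>\<pi>(\<epsilon>\<^sup>-\<^sup>2 - r\<^sup>-\<^sup>2 + \<Sum> n\<bar>b\<^sub>n\<bar>\<^sup>2 (r\<^sup>2\<^sup>n - \<epsilon>\<^sup>2\<^sup>n))\<close> (\<open>area_in_log_coordinates\<close>). On the other
  hand that image lies inside the curve traced by \<open>G\<close> on \<open>\<bar>z\<bar> = \<epsilon>\<close>, which up to an error \<open>O(\<epsilon>\<^sup>2)\<close> is the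
  ellipse traced by \<open>z \<mapsto> \<epsilon>\<^sup>-\<^sup>2 cnj z + b\<^sub>1 z\<close>, of area at most \<open>\<pi>\<epsilon>\<^sup>-\<^sup>2\<close> up to an error that tends to \<open>0\<close>
  (\<open>image_enclosed_by_ellipse\<close>). Letting \<open>\<epsilon> \<rightarrow> 0\<close> and then \<open>r \<rightarrow> 1\<close> gives \<open>\<Sum> n\<bar>b\<^sub>n\<bar>\<^sup>2 \<le> 1\<close>.
\<close>

section \<open>Areas of planar images\<close>

text \<open>
  Determinants and the change-of-variables formula live on \<open>real^2\<close>. Areas of sets of complex numbers
  are therefore measured after transport along this isometry.
\<close>

definition vec_of_complex :: "complex \<Rightarrow> real^2" where
  "vec_of_complex z = vector [Re z, Im z]"

definition complex_of_vec :: "real^2 \<Rightarrow> complex" where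
  "complex_of_vec x = Complex (x $ 1) (x $ 2)"

lemma vec_of_complex_nth [simp]:
  "vec_of_complex z $ 1 = Re z" "vec_of_complex z $ 2 = Im z"
  by (simp_all add: vec_of_complex_def)

lemma complex_of_vec_simps [simp]:
  "Re (complex_of_vec x) = x $ 1" "Im (complex_of_vec x) = x $ 2"
  by (simp_all add: complex_of_vec_def)

lemma complex_of_vec_of_complex [simp]: "complex_of_vec (vec_of_complex z) = z"
  by (simp add: complex_eq_iff)

lemma vec_of_complex_of_vec [simp]: "vec_of_complex (complex_of_vec x) = x"
  by (simp add: vec_eq_iff forall_2)

lemma bounded_linear_vec_of_complex: "bounded_linear vec_of_complex"
  by (intro linear_conv_bounded_linear[THEN iffD1] linearI)
     (simp_all add: vec_eq_iff forall_2)

lemma bounded_linear_complex_of_vec: "bounded_linear complex_of_vec"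
  by (intro linear_conv_bounded_linear[THEN iffD1] linearI) (simp_all add: complex_eq_iff)

lemma norm_vec_of_complex: "norm (vec_of_complex z) = norm z"
  by (simp add: norm_vec_def L2_set_def sum_2 cmod_def)

lemma vec_of_complex_cball: "vec_of_complex ` cball 0 r = cball 0 r"
proof -
  have "x \<in> vec_of_complex ` cball 0 r" if "norm x \<le> r" for x
    using that norm_vec_of_complex[of "complex_of_vec x"]
    by (intro image_eqI[of _ _ "complex_of_vec x"]) auto
  then show ?thesis by (auto simp: norm_vec_of_complex)
qed

text \<open>
  Every real-linear map of the plane is \<open>z \<mapsto> a z + b cnj z\<close>, with Jacobian \<open>\<bar>a\<bar>\<^sup>2 - \<bar>b\<bar>\<^sup>2\<close>. The case
  \<open>b = 0\<close> covers complex derivatives, the general case the enclosing ellipse.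
\<close>

lemma abs_det_planar_linear:
  "\<bar>det (matrix (\<lambda>x. vec_of_complex (a * complex_of_vec x + b * cnj (complex_of_vec x))))\<bar>
     = \<bar>(norm a)\<^sup>2 - (norm b)\<^sup>2\<bar>"
proof -
  have "det (matrix (\<lambda>x. vec_of_complex (a * complex_of_vec x + b * cnj (complex_of_vec x))))
     = (norm a)\<^sup>2 - (norm b)\<^sup>2"
    unfolding cmod_power2 by (simp add: det_2 matrix_def axis_def algebra_simps power2_eq_square)
  then show ?thesis by simp
qed

lemma measure_planar_linear_image_cball:
  assumes "r \<ge> 0"
  shows "measure lebesgue (vec_of_complex ` (\<lambda>z. a * z + b * cnj z) ` cball 0 r)
           = \<bar>(norm a)\<^sup>2 - (norm b)\<^sup>2\<bar> * (pi * r\<^sup>2)"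
    and "vec_of_complex ` (\<lambda>z. a * z + b * cnj z) ` cball 0 r \<in> lmeasurable"
proof -
  let ?L = "\<lambda>x. vec_of_complex (a * complex_of_vec x + b * cnj (complex_of_vec x))"
  have eq: "vec_of_complex ` (\<lambda>z. a * z + b * cnj z) ` cball 0 r = ?L ` cball 0 r"
    by (simp add: vec_of_complex_cball[symmetric] image_image del: vec_of_complex_of_vec)
  have lin: "linear ?L"
    by (intro linearI) (simp_all add: vec_eq_iff forall_2 algebra_simps)
  show "measure lebesgue (vec_of_complex ` (\<lambda>z. a * z + b * cnj z) ` cball 0 r)
           = \<bar>(norm a)\<^sup>2 - (norm b)\<^sup>2\<bar> * (pi * r\<^sup>2)"
    unfolding eq using assms
    by (subst measure_linear_image[OF lin])
       (auto simp: abs_det_planar_linear content_cball unit_ball_vol_2)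
  show "vec_of_complex ` (\<lambda>z. a * z + b * cnj z) ` cball 0 r \<in> lmeasurable"
    unfolding eq by (rule measurable_linear_image[OF lin]) auto
qed

lemma mem_cbox_2: fixes x :: "real^2"
  shows "x \<in> cbox u v \<longleftrightarrow> u $ 1 \<le> x $ 1 \<and> x $ 1 \<le> v $ 1 \<and> u $ 2 \<le> x $ 2 \<and> x $ 2 \<le> v $ 2"
  by (auto simp: mem_box_cart forall_2)

lemma vec_of_complex_image_box: "vec_of_complex ` box p q = box (vec_of_complex p) (vec_of_complex q)"
proof -
  have "x \<in> vec_of_complex ` box p q" if "x \<in> box (vec_of_complex p) (vec_of_complex q)" for x
    using that by (intro image_eqI[of _ _ "complex_of_vec x"])
      (auto simp: in_box_complex_iff mem_box_cart forall_2)
  then show ?thesis by (auto simp: in_box_complex_iff mem_box_cart forall_2)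
qed

text \<open>
  Fubini for the plane. The iterated-integral theorem speaks about \<open>real \<times> real\<close>, so the integral is
  carried to \<open>real^2\<close> along the coordinate map, which sends boxes to boxes of the same content.
\<close>

lemma integral_planar_box:
  fixes F :: "complex \<Rightarrow> real"
  assumes "continuous_on (cbox p q) F"
  shows "((\<lambda>x. F (complex_of_vec x)) has_integral
           integral {Re p..Re q} (\<lambda>s. integral {Im p..Im q} (\<lambda>t. F (Complex s t))))
         (cbox (vec_of_complex p) (vec_of_complex q))"
proof -
  let ?B = "cbox (Re p, Im p) (Re q, Im q)"
  let ?F = "\<lambda>(s, t). F (Complex s t)"
  have cont: "continuous_on ?B ?F"
    unfolding case_prod_beta
    by (rule continuous_on_compose2[OF assms])
       (auto intro!: continuous_intros simp: in_cbox_complex_iff Complex_eq)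
  let ?g = "\<lambda>x::real^2. (x $ 1, x $ 2)"
  let ?h = "\<lambda>(s, t). vec_of_complex (Complex s t)"
  have gbox: "?g ` cbox u v = cbox (?g u) (?g v)" for u v
  proof -
    have "y \<in> ?g ` cbox u v" if "y \<in> cbox (?g u) (?g v)" for y
      using that by (intro image_eqI[of _ _ "?h y"]) (auto simp: mem_cbox_2 cbox_Pair_eq)
    then show ?thesis by (auto simp: mem_cbox_2 cbox_Pair_eq)
  qed
  have hbox: "?h ` cbox u v = cbox (?h u) (?h v)" for u v
  proof -
    obtain s t s' t' where uv: "u = (s, t)" "v = (s', t')" by (metis surj_pair)
    have "y \<in> ?h ` cbox u v" if "y \<in> cbox (?h u) (?h v)" for y
      using that unfolding uv by (intro image_eqI[of _ _ "?g y"])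
        (auto simp: mem_cbox_2 cbox_Pair_eq vec_eq_iff forall_2)
    then show ?thesis unfolding uv by (auto simp: mem_cbox_2 cbox_Pair_eq)
  qed
  have "((\<lambda>x. ?F (?g x)) has_integral (1 / 1) *\<^sub>R integral ?B ?F) (?h ` ?B)"
  proof (rule has_integral_twiddle)
    show "continuous (at x) ?g" for x by (intro continuous_intros)
    show "measure lborel (?g ` cbox u v) = 1 * measure lborel (cbox u v)" for u v
    proof -
      have "measure lborel (cbox u v) = (if cbox u v = {} then 0 else (v$1 - u$1) * (v$2 - u$2))"
        by (simp add: content_cbox_if_cart UNIV_2)
      moreover have "cbox u v = {} \<longleftrightarrow> u$1 > v$1 \<or> u$2 > v$2"
        using forall_2[of "\<lambda>i. \<not> v $ i < u $ i"] unfolding interval_eq_empty_cart by blast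
      ultimately show ?thesis
        unfolding gbox content_Pair by (auto simp: content_real_if)
    qed
    show "(?F has_integral integral ?B ?F) ?B"
      using integrable_continuous[OF cont] by (simp add: integrable_integral)
    show "\<exists>w z. ?g ` cbox u v = cbox w z" for u v using gbox by blast
    show "\<exists>w z. ?h ` cbox u v = cbox w z" for u v using hbox by blast
  qed (auto simp: vec_eq_iff forall_2)
  moreover have "integral ?B ?F = integral {Re p..Re q} (\<lambda>s. integral {Im p..Im q} (\<lambda>t. F (Complex s t)))"
    using integral_prod_continuous[OF cont] by simp
  ultimately show ?thesis by (simp add: hbox complex_of_vec_def)
qed

text \<open>
  Injectivity is asked on the open box only: a rectangle of height \<open>2\<pi>\<close> in logarithmic coordinates
  wraps around the annulus, and \<open>exp\<close> identifies its two horizontal edges, which have measure zero.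
\<close>

theorem measure_holomorphic_image_box:
  assumes hol: "f holomorphic_on U" and "open U" and sub: "cbox p q \<subseteq> U"
    and inj: "inj_on f (box p q)"
  shows "measure lebesgue (vec_of_complex ` f ` box p q)
           = integral {Re p..Re q} (\<lambda>s. integral {Im p..Im q} (\<lambda>t. (norm (deriv f (Complex s t)))\<^sup>2))"
    and "vec_of_complex ` f ` box p q \<in> lmeasurable"
proof -
  let ?I = "integral {Re p..Re q} (\<lambda>s. integral {Im p..Im q} (\<lambda>t. (norm (deriv f (Complex s t)))\<^sup>2))"
  let ?S = "box (vec_of_complex p) (vec_of_complex q)"
  let ?T = "\<lambda>x. vec_of_complex (f (complex_of_vec x))"
  let ?D = "\<lambda>x h. vec_of_complex (deriv f (complex_of_vec x) * complex_of_vec h)"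
  have eq: "vec_of_complex ` f ` box p q = ?T ` ?S"
    by (simp add: vec_of_complex_image_box[symmetric] image_image)
  have det: "\<bar>det (matrix (?D x))\<bar> = (norm (deriv f (complex_of_vec x)))\<^sup>2" for x
    using abs_det_planar_linear[of "deriv f (complex_of_vec x)" 0] by simp
  have "continuous_on (cbox p q) (\<lambda>z. (norm (deriv f z))\<^sup>2)"
    by (intro continuous_intros holomorphic_on_imp_continuous_on holomorphic_deriv
          holomorphic_on_subset[OF holomorphic_deriv[OF hol \<open>open U\<close>] sub])
  from integral_planar_box[OF this]
  have int: "((\<lambda>x. \<bar>det (matrix (?D x))\<bar>) has_integral ?I) ?S"
    by (simp add: det has_integral_open_interval)
  have in_box: "complex_of_vec x \<in> box p q" if "x \<in> ?S" for x
    using that by (auto simp: in_box_complex_iff mem_box_cart forall_2)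
  have der: "(?T has_derivative ?D x) (at x within ?S)" if "x \<in> ?S" for x
  proof -
    have "complex_of_vec x \<in> U"
      using in_box[OF that] sub box_subset_cbox by blast
    then have "(f has_field_derivative deriv f (complex_of_vec x)) (at (complex_of_vec x))"
      using hol \<open>open U\<close> holomorphic_derivI by blast
    then have "(f has_derivative (*) (deriv f (complex_of_vec x))) (at (complex_of_vec x))"
      by (simp add: has_field_derivative_def)
    moreover have "(complex_of_vec has_derivative complex_of_vec) (at x within ?S)"
      by (rule bounded_linear_imp_has_derivative[OF bounded_linear_complex_of_vec])
    ultimately show ?thesis
      by (intro bounded_linear.has_derivative[OF bounded_linear_vec_of_complex])
         (rule has_derivative_compose)
  qed
  have injT: "inj_on ?T ?S"
  proof (rule inj_onI)
    fix x y assume "x \<in> ?S" "y \<in> ?S" "?T x = ?T y"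
    then have "complex_of_vec x = complex_of_vec y"
      by (metis complex_of_vec_of_complex in_box inj inj_onD)
    then show "x = y" by (metis vec_of_complex_of_vec)
  qed
  have intb: "(\<lambda>x. \<bar>det (matrix (?D x))\<bar>) integrable_on ?S" using int by blast
  have S: "?S \<in> sets lebesgue" by auto
  show "measure lebesgue (vec_of_complex ` f ` box p q) = ?I"
    unfolding eq using measure_differentiable_image_eq[OF S der injT intb] int
    by (simp add: integral_unique)
  show "vec_of_complex ` f ` box p q \<in> lmeasurable"
    unfolding eq using measurable_differentiable_image_eq[OF S der injT] intb by blast
qed

section \<open>Bessel's inequality on circles\<close>

lemma circle_mean_value:
  assumes hol: "g holomorphic_on ball 0 1" and r: "0 < r" "r < 1"
  shows "((\<lambda>t. g (of_real r * cis t)) has_integral 2 * of_real pi * g 0) {0..2 * pi}"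
proof -
  have "((\<lambda>z. g z / (z - 0)) has_contour_integral 2 * of_real pi * \<i> * g 0) (circlepath 0 r)"
  proof (rule Cauchy_integral_circlepath)
    have "cball 0 r \<subseteq> ball (0::complex) 1" using r by auto
    then show "continuous_on (cball 0 r) g"
      using hol holomorphic_on_imp_continuous_on holomorphic_on_subset by blast
    show "g holomorphic_on ball 0 r" by (rule holomorphic_on_subset[OF hol]) (use r in auto)
  qed (use r in auto)
  then have "((\<lambda>t. g (of_real r * cis t) * \<i>) has_integral 2 * of_real pi * \<i> * g 0) {0..2 * pi}"
    using r by (simp add: circlepath_def has_contour_integral_part_circlepath_iff field_simps)
  from has_integral_mult_left[OF this, of "-\<i>"] show ?thesis by (simp add: mult_ac)
qed

lemma power_series_tail:
  fixes c :: "nat \<Rightarrow> complex"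
  assumes "\<And>z. norm z < 1 \<Longrightarrow> (\<lambda>n. c n * z ^ n) sums g z"
  shows "\<exists>g1. \<forall>z. norm z < 1 \<longrightarrow> (\<lambda>n. c (Suc n) * z ^ n) sums g1 z \<and> g z = c 0 + z * g1 z"
proof -
  define g1 where "g1 z = (\<Sum>n. c (Suc n) * z ^ n)" for z
  have "(\<lambda>n. c (Suc n) * z ^ n) sums g1 z" if "norm z < 1" for z
  proof -
    have "summable (\<lambda>n. c (Suc n) * z ^ n)"
      using powser_split_head(3)[of c z] assms[OF that] by (simp add: sums_iff)
    then show ?thesis by (simp add: g1_def summable_sums)
  qed
  moreover have "g z = c 0 + z * g1 z" if "norm z < 1" for z
    using powser_split_head(1)[of c z] assms[OF that] by (simp add: sums_iff g1_def mult_ac)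
  ultimately show ?thesis by blast
qed

lemma power_series_unit_disc_holomorphic:
  assumes "\<And>z. norm z < 1 \<Longrightarrow> (\<lambda>n. c n * z ^ n) sums g z"
  shows "g holomorphic_on ball 0 1"
  by (rule power_series_holomorphic[of _ _ c]) (use assms in auto)

text \<open>
  Peel off one coefficient at a time: with \<open>g = c\<^sub>0 + z g\<^sub>1\<close> one has
  \<open>\<bar>g\<bar>\<^sup>2 = \<bar>c\<^sub>0\<bar>\<^sup>2 + 2 Re (cnj c\<^sub>0 z g\<^sub>1) + r\<^sup>2 \<bar>g\<^sub>1\<bar>\<^sup>2\<close> on the circle of radius \<open>r\<close>, and the middle term
  integrates to \<open>0\<close> by the mean value property because \<open>z g\<^sub>1\<close> vanishes at the origin.
\<close>

lemma bessel_on_circle: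
  assumes "\<And>z. norm z < 1 \<Longrightarrow> (\<lambda>n. c n * z ^ n) sums g z" and r: "0 < r" "r < 1"
  shows "2 * pi * (\<Sum>k<n. (norm (c k))\<^sup>2 * r ^ (2 * k))
           \<le> integral {0..2 * pi} (\<lambda>t. (norm (g (of_real r * cis t)))\<^sup>2)"
  using assms(1)
proof (induction n arbitrary: c g)
  case 0
  show ?case
    by (cases "(\<lambda>t. (norm (g (of_real r * cis t)))\<^sup>2) integrable_on {0..2 * pi}")
       (auto simp: not_integrable_integral intro: integral_nonneg)
next
  case (Suc n)
  obtain g1 where g1: "\<And>z. norm z < 1 \<Longrightarrow> (\<lambda>n. c (Suc n) * z ^ n) sums g1 z"
    and split: "\<And>z. norm z < 1 \<Longrightarrow> g z = c 0 + z * g1 z"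
    using power_series_tail[of c g, OF Suc.prems] by blast
  have hol1: "g1 holomorphic_on ball 0 1" using g1 by (rule power_series_unit_disc_holomorphic)
  have nrm: "norm (of_real r * cis t) < 1" for t using r by (simp add: norm_mult)
  have cont: "continuous_on {0..2*pi} (\<lambda>t. g1 (of_real r * cis t))"
    by (rule continuous_on_compose2[OF holomorphic_on_imp_continuous_on[OF hol1]])
       (use nrm in \<open>auto intro!: continuous_intros\<close>)
  let ?J = "integral {0..2 * pi} (\<lambda>t. (norm (g1 (of_real r * cis t)))\<^sup>2)"
  have int1: "((\<lambda>t. (norm (g1 (of_real r * cis t)))\<^sup>2) has_integral ?J) {0..2*pi}"
    by (intro integrable_integral integrable_continuous_real continuous_intros cont)
  have "((\<lambda>t. cnj (c 0) * (of_real r * cis t * g1 (of_real r * cis t))) has_integral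
          cnj (c 0) * (2 * of_real pi * (0 * g1 0))) {0..2*pi}"
    by (intro has_integral_mult_right circle_mean_value[where g = "\<lambda>z. z * g1 z"]
          holomorphic_intros hol1 r)
  from has_integral_linear[OF this bounded_linear_Re]
  have cross: "((\<lambda>t. Re (cnj (c 0) * (of_real r * cis t * g1 (of_real r * cis t)))) has_integral 0) {0..2*pi}"
    by (simp add: o_def)
  have exp: "(norm (g (of_real r * cis t)))\<^sup>2 = (norm (c 0))\<^sup>2 +
      2 * Re (cnj (c 0) * (of_real r * cis t * g1 (of_real r * cis t)))
      + r\<^sup>2 * (norm (g1 (of_real r * cis t)))\<^sup>2" for t
  proof -
    have sq: "(norm (a + b))\<^sup>2 = (norm a)\<^sup>2 + 2 * Re (cnj a * b) + (norm b)\<^sup>2" for a b :: complex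
      unfolding cmod_power2 by (simp add: power2_eq_square algebra_simps)
    show ?thesis unfolding split[OF nrm] sq using r by (simp add: norm_mult power_mult_distrib)
  qed
  have "((\<lambda>t. (norm (g (of_real r * cis t)))\<^sup>2) has_integral
      (2 * pi * (norm (c 0))\<^sup>2 + 2 * 0) + r\<^sup>2 * ?J) {0..2*pi}"
    unfolding exp
    by (intro has_integral_add has_integral_mult_right int1 cross)
       (use has_integral_const_real[of "(norm (c 0))\<^sup>2" 0 "2*pi"] in simp)
  then have I: "integral {0..2 * pi} (\<lambda>t. (norm (g (of_real r * cis t)))\<^sup>2)
      = 2 * pi * (norm (c 0))\<^sup>2 + r\<^sup>2 * ?J"
    by (simp add: integral_unique)
  have "2 * pi * (\<Sum>k<Suc n. (norm (c k))\<^sup>2 * r ^ (2 * k))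
     = 2 * pi * (norm (c 0))\<^sup>2 + r\<^sup>2 * (2 * pi * (\<Sum>k<n. (norm (c (Suc k)))\<^sup>2 * r ^ (2 * k)))"
    by (simp add: sum.lessThan_Suc_shift sum_distrib_left algebra_simps power2_eq_square del: sum.lessThan_Suc)
  also have "\<dots> \<le> 2 * pi * (norm (c 0))\<^sup>2 + r\<^sup>2 * ?J"
    using Suc.IH[of "\<lambda>k. c (Suc k)" g1] g1 by (intro add_left_mono mult_left_mono) auto
  finally show ?case using I by simp
qed

section \<open>Enclosing the image of an annulus\<close>

text \<open>
  A connectedness argument. The complement of the convex compact set \<open>E\<close> is connected. The values
  that \<open>G = 1/z + h\<close> takes on \<open>0 < \<bar>z\<bar> < \<epsilon>\<close> outside \<open>E\<close> form a nonempty subset of it (\<open>G\<close> has a pole)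
  that is open (open mapping) and relatively closed (\<open>G\<close> maps the bounding circle into \<open>E\<close>). So
  every value outside \<open>E\<close> is already attained near the origin, and injectivity forbids taking it
  again on \<open>\<epsilon> \<le> \<bar>z\<bar> < 1\<close>. The bound on \<open>z h(z)\<close> makes \<open>G\<close> zero-free on the small disc.
\<close>

lemma outer_annulus_image_enclosed:
  assumes E: "compact E" "convex E" "0 \<in> E" and eps: "0 < \<epsilon>" "\<epsilon> < 1"
    and holh: "h holomorphic_on ball 0 1"
    and inj: "inj_on (\<lambda>z. 1 / z + h z) (ball 0 1 - {0})"
    and small: "\<And>z. norm z \<le> \<epsilon> \<Longrightarrow> norm (z * h z) < 1"
    and circ: "\<And>z. norm z = \<epsilon> \<Longrightarrow> 1 / z + h z \<in> E"
    and z: "\<epsilon> \<le> norm z" "norm z < 1"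
  shows "1 / z + h z \<in> E"
proof (rule ccontr)
  let ?G = "\<lambda>z. 1 / z + h z"
  assume notE: "?G z \<notin> E"
  define A where "A = - E \<inter> ?G ` (ball 0 \<epsilon> - {0})"
  have sub: "ball 0 \<epsilon> - {0} \<subseteq> ball 0 1 - {0::complex}" using eps by auto
  have nz: "1 + w * h w \<noteq> 0" if "norm w \<le> \<epsilon>" for w
    using small[OF that] by (metis add_eq_0_iff norm_minus_cancel norm_one order_less_irrefl)
  have conn: "connected (- E)"
    using connected_complement_bounded_convex[of E] E by (simp add: compact_imp_bounded)
  have opE: "open (- E)" using E by (simp add: compact_imp_closed open_Compl)
  have "open (?G ` (ball 0 \<epsilon> - {0}))"
  proof (rule open_mapping_thm3)
    show "?G holomorphic_on ball 0 \<epsilon> - {0}"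
      by (intro holomorphic_intros holomorphic_on_subset[OF holh]) (use eps in auto)
  qed (use inj_on_subset[OF inj sub] in auto)
  then have opA: "open A" unfolding A_def using opE by blast
  \<comment> \<open>\<open>1 / G\<close> extends continuously to the origin, so it maps the closed disc to a compact set\<close>
  define F where "F w = w / (1 + w * h w)" for w
  have contF: "continuous_on (cball 0 \<epsilon>) F"
    unfolding F_def
    by (intro continuous_intros holomorphic_on_imp_continuous_on holomorphic_on_subset[OF holh])
       (use eps nz in auto)
  have "closed (F ` cball 0 \<epsilon>)"
    by (intro compact_imp_closed compact_continuous_image contF compact_cball)
  moreover have "continuous_on (- E) (inverse :: complex \<Rightarrow> complex)"
    using E by (intro continuous_intros) auto
  ultimately have cl: "closedin (top_of_set (- E)) (- E \<inter> inverse -` (F ` cball 0 \<epsilon>))"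
    by (rule continuous_closedin_preimage[rotated])
  have FG: "F w = inverse (?G w)" if "w \<noteq> 0" "norm w \<le> \<epsilon>" for w
    using that nz[OF that(2)] by (simp add: F_def field_simps)
  have "A = - E \<inter> inverse -` (F ` cball 0 \<epsilon>)"
  proof (intro equalityI subsetI)
    fix v assume "v \<in> A"
    then obtain w where "v \<notin> E" "v = ?G w" "w \<in> ball 0 \<epsilon> - {0}" unfolding A_def by blast
    then have w: "v \<notin> E" "v = ?G w" "norm w < \<epsilon>" "w \<noteq> 0" by simp_all
    then have "inverse v = F w" using FG[of w] by simp
    then show "v \<in> - E \<inter> inverse -` (F ` cball 0 \<epsilon>)" using w by auto
  next
    fix v assume "v \<in> - E \<inter> inverse -` (F ` cball 0 \<epsilon>)"
    then obtain w where w: "v \<notin> E" "inverse v = F w" "norm w \<le> \<epsilon>" by auto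
    have "v \<noteq> 0" using w(1) E(3) by auto
    have "w \<noteq> 0" using w(2) \<open>v \<noteq> 0\<close> by (auto simp: F_def)
    have v: "v = ?G w" using FG[OF \<open>w \<noteq> 0\<close> w(3)] w(2) by (metis inverse_eq_iff_eq)
    then have "norm w \<noteq> \<epsilon>" using circ[of w] w(1) by auto
    then show "v \<in> A" using w v \<open>w \<noteq> 0\<close> by (auto simp: A_def)
  qed
  with cl have clA: "closedin (top_of_set (- E)) A" by simp
  have opinA: "openin (top_of_set (- E)) A"
    using opA opE by (auto simp: openin_open_eq A_def)
  have "A \<noteq> {}"
  proof -
    obtain B where B: "\<And>v. v \<in> E \<Longrightarrow> norm v \<le> B" 
      using compact_imp_bounded[OF E(1)] bounded_iff by metis
    have "0 \<le> B" using B[OF E(3)] by simp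
    obtain M where M: "\<And>w. w \<in> cball 0 \<epsilon> \<Longrightarrow> norm (h w) \<le> M"
    proof -
      have "continuous_on (cball 0 \<epsilon>) h"
        by (intro holomorphic_on_imp_continuous_on holomorphic_on_subset[OF holh]) (use eps in auto)
      then have "bounded (h ` cball 0 \<epsilon>)"
        by (intro compact_imp_bounded compact_continuous_image compact_cball)
      then obtain M where "\<forall>x\<in>h ` cball 0 \<epsilon>. norm x \<le> M" unfolding bounded_iff by blast
      then show thesis using that by blast
    qed
    have "0 \<le> M" using M[of 0] eps by (smt (verit) centre_in_cball norm_ge_zero)
    define d where "d = min (\<epsilon> / 2) (1 / (B + M + 1))"
    have d: "0 < d" "d < \<epsilon>" "d \<le> 1 / (B + M + 1)"
      using eps \<open>0 \<le> B\<close> \<open>0 \<le> M\<close> by (auto simp: d_def)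
    have "B + M + 1 \<le> 1 / d" using d \<open>0 \<le> B\<close> \<open>0 \<le> M\<close> by (simp add: field_simps)
    then have "B < norm (1 / complex_of_real d) - norm (h (of_real d))"
      using M[of "of_real d"] d by (simp add: norm_divide)
    also have "\<dots> \<le> norm (?G (of_real d))" by (metis norm_diff_ineq)
    finally have "?G (of_real d) \<notin> E" using B by force
    then show ?thesis using d by (auto simp: A_def)
  qed
  with conn clA opinA have "A = - E" unfolding connected_clopen by blast
  with notE have "?G z \<in> A" by blast
  then obtain w where "?G z = ?G w" "w \<in> ball 0 \<epsilon> - {0}" unfolding A_def by blast
  then have w: "?G z = ?G w" "norm w < \<epsilon>" "w \<noteq> 0" by simp_all
  moreover have "z \<noteq> 0" using z eps by auto
  ultimately have "z = w" using inj_onD[OF inj, of z w] z eps by auto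
  with w z show False by simp
qed

text \<open>
  On \<open>\<bar>z\<bar> = \<epsilon>\<close> we have \<open>1/z = \<epsilon>\<^sup>-\<^sup>2 cnj z\<close>, so \<open>G(z) = L z + O(\<epsilon>\<^sup>2)\<close> for the real-linear map
  \<open>L v = b\<^sub>1 v + \<epsilon>\<^sup>-\<^sup>2 cnj v\<close>. Since \<open>L\<close> expands lengths by at least \<open>\<epsilon>\<^sup>-\<^sup>2 / 2\<close>, the error term is
  \<open>L v\<close> for some \<open>v\<close> of size \<open>O(\<epsilon>\<^sup>4)\<close>, and the circle goes into the \<open>L\<close>-image of a slightly larger
  disc. This precision is what the area theorem needs: a cruder \<open>\<epsilon> + O(\<epsilon>\<^sup>3)\<close> would spoil the area by
  a constant that does not vanish with \<open>\<epsilon>\<close>.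
\<close>

lemma image_enclosed_by_ellipse:
  fixes b :: "nat \<Rightarrow> complex"
  assumes h: "\<And>z. norm z < 1 \<Longrightarrow> (\<lambda>n. b n * z ^ n) sums h z" and b0: "b 0 = 0"
    and inj: "inj_on (\<lambda>z. 1 / z + h z) (ball 0 1 - {0})"
  obtains C \<delta> where "C \<ge> 0" "0 < \<delta>" "\<delta> < 1"
    and "\<And>\<epsilon>. 0 < \<epsilon> \<Longrightarrow> \<epsilon> < \<delta> \<Longrightarrow> norm (b 1) \<le> 1 / \<epsilon>\<^sup>2"
    and "\<And>\<epsilon> z. 0 < \<epsilon> \<Longrightarrow> \<epsilon> < \<delta> \<Longrightarrow> \<epsilon> \<le> norm z \<Longrightarrow> norm z < 1 \<Longrightarrow>
       1 / z + h z \<in> (\<lambda>v. b 1 * v + of_real (1 / \<epsilon>\<^sup>2) * cnj v) ` cball 0 (\<epsilon> + C * \<epsilon> ^ 4)"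
proof -
  obtain h1 where h1: "\<And>z. norm z < 1 \<Longrightarrow> (\<lambda>n. b (Suc n) * z ^ n) sums h1 z"
    and hh1: "\<And>z. norm z < 1 \<Longrightarrow> h z = b 0 + z * h1 z"
    using power_series_tail[of b h, OF h] by blast
  obtain q where q: "\<And>z. norm z < 1 \<Longrightarrow> (\<lambda>n. b (Suc (Suc n)) * z ^ n) sums q z"
    and h1q: "\<And>z. norm z < 1 \<Longrightarrow> h1 z = b (Suc 0) + z * q z"
    using power_series_tail[of "\<lambda>n. b (Suc n)" h1, OF h1] by blast
  have hq: "h z = b 1 * z + z\<^sup>2 * q z" if "norm z < 1" for z
    using hh1[OF that] h1q[OF that] b0 by (simp add: algebra_simps power2_eq_square)
  have holh: "h holomorphic_on ball 0 1" using h by (rule power_series_unit_disc_holomorphic)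
  have "q holomorphic_on ball 0 1" using q by (rule power_series_unit_disc_holomorphic)
  then have "continuous_on (cball 0 (1/2)) q"
    by (intro holomorphic_on_imp_continuous_on) (auto elim: holomorphic_on_subset)
  then have "bounded (q ` cball 0 (1/2))"
    by (intro compact_imp_bounded compact_continuous_image compact_cball)
  then obtain M where "\<forall>x\<in>q ` cball 0 (1/2). norm x \<le> M" unfolding bounded_iff by blast
  then have M: "\<And>z. norm z \<le> 1/2 \<Longrightarrow> norm (q z) \<le> M" by auto
  have "0 \<le> M" using M[of 0] by (smt (verit) norm_ge_zero norm_zero zero_less_divide_1_iff)
  \<comment> \<open>\<open>\<delta>\<close> is chosen so that \<open>\<epsilon>\<^sup>2 \<bar>b\<^sub>1\<bar>\<close>, and \<open>\<bar>z h(z)\<bar>\<close> on the disc of radius \<open>\<epsilon>\<close>,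
     are at most \<open>1/2\<close>; the factor \<open>2\<close>
     in \<open>C\<close> undoes the expansion constant of \<open>L\<close>\<close>
  define C where "C = 2 * M"
  define D where "D = norm (b 1) + M + 1"
  define \<delta> where "\<delta> = 1 / (2 * D)"
  have D: "D \<ge> 1" using \<open>0 \<le> M\<close> by (simp add: D_def)
  have \<delta>: "0 < \<delta>" "\<delta> \<le> 1/2" using D by (auto simp: \<delta>_def field_simps)
  have eD: "\<epsilon>\<^sup>2 * D \<le> 1 / 2" if "0 < \<epsilon>" "\<epsilon> < \<delta>" for \<epsilon>
  proof -
    have "\<epsilon> * D \<le> 1 / 2" using that D by (simp add: \<delta>_def field_simps)
    moreover have "\<epsilon> * (\<epsilon> * D) \<le> 1 * (\<epsilon> * D)"
      using that \<delta> D by (intro mult_right_mono) auto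
    ultimately show ?thesis by (simp add: power2_eq_square mult.assoc)
  qed
  have b1: "\<epsilon>\<^sup>2 * norm (b 1) \<le> 1 / 2" if "0 < \<epsilon>" "\<epsilon> < \<delta>" for \<epsilon>
  proof -
    have "\<epsilon>\<^sup>2 * norm (b 1) \<le> \<epsilon>\<^sup>2 * D" using \<open>0 \<le> M\<close> by (intro mult_left_mono) (auto simp: D_def)
    then show ?thesis using eD[OF that] by simp
  qed
  show thesis
  proof
    show "C \<ge> 0" using \<open>0 \<le> M\<close> by (simp add: C_def)
    show "0 < \<delta>" "\<delta> < 1" using \<delta> by auto
    show "norm (b 1) \<le> 1 / \<epsilon>\<^sup>2" if "0 < \<epsilon>" "\<epsilon> < \<delta>" for \<epsilon>
      using b1[OF that] that by (simp add: field_simps)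
    fix \<epsilon> :: real and z :: complex assume eps: "0 < \<epsilon>" "\<epsilon> < \<delta>" and z: "\<epsilon> \<le> norm z" "norm z < 1"
    define L where "L v = b 1 * v + of_real (1 / \<epsilon>\<^sup>2) * cnj v" for v
    have linL: "linear L" by (intro linearI) (simp_all add: L_def algebra_simps add_divide_distrib scaleR_conv_of_real)
    have lowL: "norm (L v) \<ge> norm v / (2 * \<epsilon>\<^sup>2)" for v
    proof -
      have "norm v / \<epsilon>\<^sup>2 - norm (b 1) * norm v \<le> norm (L v)"
        using norm_diff_ineq[of "of_real (1 / \<epsilon>\<^sup>2) * cnj v" "b 1 * v"] eps
        by (simp add: L_def norm_mult norm_divide norm_power add.commute)
      moreover have "norm (b 1) * norm v \<le> 1 / (2 * \<epsilon>\<^sup>2) * norm v"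
        using b1[OF eps] eps by (intro mult_right_mono) (auto simp: field_simps)
      moreover have "norm v / \<epsilon>\<^sup>2 = norm v / (2 * \<epsilon>\<^sup>2) + 1 / (2 * \<epsilon>\<^sup>2) * norm v" using eps by (simp add: field_simps)
      ultimately show ?thesis by linarith
    qed
    have "inj L"
    proof (rule linear_injective_0[OF linL, THEN iffD2], intro allI impI)
      fix v assume "L v = 0" then show "v = 0" using lowL[of v] eps by (simp add: divide_le_0_iff)
    qed
    then have "surj L" using linL linear_injective_imp_surjective by blast
    let ?E = "L ` cball 0 (\<epsilon> + C * \<epsilon> ^ 4)"
    have "1 / z + h z \<in> ?E"
    proof (rule outer_annulus_image_enclosed[OF _ _ _ _ _ holh inj])
      show "compact ?E"
        by (intro compact_continuous_image compact_cball linear_continuous_on linL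
              linear_conv_bounded_linear[THEN iffD1])
      show "convex ?E" by (intro convex_linear_image linL convex_cball)
      have "L 0 = 0" by (simp add: L_def)
      then show "0 \<in> ?E" using eps \<open>C \<ge> 0\<close> by (intro image_eqI[of _ _ 0]) auto
      show "norm (w * h w) < 1" if "norm w \<le> \<epsilon>" for w
      proof -
        have w: "norm w \<le> 1/2" using that eps \<delta> by simp
        have "norm (w * h w) = (norm w)\<^sup>2 * norm (b 1 + w * q w)"
          using hq[of w] w by (simp add: norm_mult power2_eq_square algebra_simps flip: norm_mult)
        also have "\<dots> \<le> \<epsilon>\<^sup>2 * D"
        proof (intro mult_mono power_mono that)
          have "norm (b 1 + w * q w) \<le> norm (b 1) + norm w * norm (q w)"
            by (metis norm_mult norm_triangle_ineq)
          also have "norm w * norm (q w) \<le> 1 * M" using w M[OF w] by (intro mult_mono) auto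
          finally show "norm (b 1 + w * q w) \<le> D" by (simp add: D_def)
        qed auto
        finally show ?thesis using eD[OF eps] by simp
      qed
      show "1 / w + h w \<in> ?E" if w: "norm w = \<epsilon>" for w
      proof -
        have w12: "norm w \<le> 1/2" using w eps \<delta> by simp
        obtain v where v: "w\<^sup>2 * q w = L v" using \<open>surj L\<close> by (metis surjD)
        have "norm (L v) \<le> \<epsilon>\<^sup>2 * M"
          unfolding v[symmetric] using M[OF w12] w by (simp add: norm_mult norm_power mult_left_mono)
        then have "norm v / (2 * \<epsilon>\<^sup>2) \<le> \<epsilon>\<^sup>2 * M" using lowL[of v] by simp
        then have nv: "norm v \<le> C * \<epsilon> ^ 4" using eps by (simp add: C_def field_simps power_numeral_reduce)
        have "w * cnj w = of_real (\<epsilon>\<^sup>2)" using w by (simp add: complex_norm_square[symmetric])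
        then have "1 / w = of_real (1 / \<epsilon>\<^sup>2) * cnj w" using w eps
          by (auto simp: field_simps)
        then have "1 / w + h w = L w + L v" using hq[of w] w12 v by (simp add: L_def)
        also have "\<dots> = L (w + v)" using linL by (simp add: linear_add)
        finally show ?thesis using nv w norm_triangle_ineq[of w v] by (intro image_eqI[of _ _ "w + v"]) auto
      qed
    qed (use eps \<delta> z in auto)
    then show "1 / z + h z \<in> (\<lambda>v. b 1 * v + of_real (1 / \<epsilon>\<^sup>2) * cnj v) ` cball 0 (\<epsilon> + C * \<epsilon> ^ 4)"
      by (simp add: L_def[abs_def])
  qed
qed

section \<open>The area theorem\<close>

text \<open>
  Up to the factor \<open>\<pi>\<close>, the area, counted with multiplicity, of the image of the disc of radius \<open>r\<close>
  under the polynomial \<open>\<Sum> b\<^sub>k z\<^sup>k\<close> (\<open>1 \<le> k \<le> n\<close>).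
\<close>
definition polynomial_area :: "(nat \<Rightarrow> complex) \<Rightarrow> nat \<Rightarrow> real \<Rightarrow> real" where
  "polynomial_area b n r = (\<Sum>k<n. real (Suc k) * (norm (b (Suc k)))\<^sup>2 * r ^ (2 * k + 2))"

text \<open>
  With \<open>K(\<zeta>) = G(exp \<zeta>)\<close> one has \<open>K'(\<zeta>) = exp(-\<zeta>) N(exp \<zeta>)\<close> for the power series
  \<open>N(z) = z\<^sup>2 h'(z) - 1 = -1 + \<Sum> k b\<^sub>k z\<^sup>k\<^sup>+\<^sup>1\<close>. On a vertical segment of the half-plane \<open>exp \<zeta>\<close> runs
  through a circle, so Bessel's inequality for \<open>N\<close> bounds the inner integral, and the resulting sum
  of exponentials has an explicit primitive in \<open>s\<close>.
\<close>

lemma area_in_log_coordinates: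
  fixes b :: "nat \<Rightarrow> complex"
  assumes h: "\<And>z. norm z < 1 \<Longrightarrow> (\<lambda>n. b n * z ^ n) sums h z"
    and s: "s0 \<le> s1" "s1 < 0"
  defines "K \<equiv> \<lambda>\<zeta>. exp (- \<zeta>) + h (exp \<zeta>)"
  shows "pi * (exp (- 2 * s0) - exp (- 2 * s1) + polynomial_area b n (exp s1) - polynomial_area b n (exp s0))
     \<le> integral {s0..s1} (\<lambda>s. integral {0..2*pi} (\<lambda>t. (norm (deriv K (Complex s t)))\<^sup>2))"
    and "K holomorphic_on {\<zeta>. Re \<zeta> < 0}"
proof -
  have holh: "h holomorphic_on ball 0 1" using h by (rule power_series_unit_disc_holomorphic)
  \<comment> \<open>\<open>c\<close> lists the coefficients of \<open>N\<close>; the coefficient of \<open>z\<close> is \<open>0 * b 0 = 0\<close>\<close>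
  define N where "N z = z\<^sup>2 * deriv h z - 1" for z
  define c where "c k = (if k = 0 then -1 else of_nat (k - 1) * b (k - 1))" for k
  have N: "(\<lambda>n. c n * z ^ n) sums N z" if z: "norm z < 1" for z
  proof -
    have "(h has_field_derivative deriv h z) (at z)"
      using holh z by (intro holomorphic_derivI[of _ "ball 0 1"]) auto
    from termdiffs_sums_strong[OF h this z]
    have "(\<lambda>n. diffs b n * z ^ n) sums deriv h z" .
    from sums_mult[OF this, of "z\<^sup>2"]
    have "(\<lambda>n. c (Suc (Suc n)) * z ^ Suc (Suc n)) sums (z\<^sup>2 * deriv h z)"
      by (simp add: c_def diffs_def power2_eq_square mult_ac)
    then have "(\<lambda>n. c (Suc n) * z ^ Suc n) sums (z\<^sup>2 * deriv h z + c (Suc 0) * z ^ Suc 0)"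
      by (rule sums_Suc)
    then have "(\<lambda>n. c n * z ^ n) sums (z\<^sup>2 * deriv h z + c (Suc 0) * z ^ Suc 0 + c 0 * z ^ 0)"
      by (rule sums_Suc)
    then show ?thesis by (simp add: N_def c_def)
  qed
  have exp1: "exp \<zeta> \<in> ball 0 1" if "Re \<zeta> < 0" for \<zeta> :: complex using that by simp
  have derK: "(K has_field_derivative exp (- \<zeta>) * N (exp \<zeta>)) (at \<zeta>)" if "Re \<zeta> < 0" for \<zeta>
  proof -
    have "(h has_field_derivative deriv h (exp \<zeta>)) (at (exp \<zeta>))"
      using holh exp1[OF that] by (intro holomorphic_derivI[of _ "ball 0 1"]) auto
    then have "((\<lambda>\<zeta>. h (exp \<zeta>)) has_field_derivative deriv h (exp \<zeta>) * exp \<zeta>) (at \<zeta>)"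
      by (rule DERIV_chain2) (auto intro!: derivative_eq_intros)
    then have "(K has_field_derivative - exp (- \<zeta>) + deriv h (exp \<zeta>) * exp \<zeta>) (at \<zeta>)"
      unfolding K_def by (auto intro!: derivative_eq_intros)
    moreover have "exp (- \<zeta>) * N (exp \<zeta>) = - exp (- \<zeta>) + deriv h (exp \<zeta>) * exp \<zeta>"
      by (simp add: N_def exp_minus field_simps power2_eq_square)
    ultimately show ?thesis by simp
  qed
  have opn: "open {\<zeta>. Re \<zeta> < 0}" by (rule open_halfspace_Re_lt)
  show holK: "K holomorphic_on {\<zeta>. Re \<zeta> < 0}"
    unfolding holomorphic_on_open[OF opn] using derK by blast
  \<comment> \<open>\<open>J\<close> is the inner integral and \<open>j\<close> its lower bound from Bessel's inequality\<close>
  define J where "J s = integral {0..2*pi} (\<lambda>t. (norm (deriv K (Complex s t)))\<^sup>2)" for s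
  define j where "j s = 2 * pi * (exp (- 2 * s) + (\<Sum>k<n. (real (Suc k))\<^sup>2 * (norm (b (Suc k)))\<^sup>2 * exp s ^ (2 * k + 2)))" for s
  have jJ: "j s \<le> J s" if "s < 0" for s
  proof -
    have e: "exp (Complex s t) = of_real (exp s) * cis t" for t
      by (simp add: exp_eq_polar)
    have nd: "(norm (deriv K (Complex s t)))\<^sup>2 = exp (- 2 * s) * (norm (N (of_real (exp s) * cis t)))\<^sup>2" for t
    proof -
      have "deriv K (Complex s t) = exp (- Complex s t) * N (of_real (exp s) * cis t)"
        using DERIV_imp_deriv[OF derK[of "Complex s t"]] that by (simp add: e)
      moreover have "exp (- s) ^ 2 = exp (- 2 * s)" by (simp flip: exp_of_nat_mult)
      ultimately show ?thesis by (simp add: norm_mult power_mult_distrib)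
    qed
    have "2 * pi * (\<Sum>k<Suc (Suc n). (norm (c k))\<^sup>2 * exp s ^ (2 * k))
        \<le> integral {0..2 * pi} (\<lambda>t. (norm (N (of_real (exp s) * cis t)))\<^sup>2)"
      by (rule bessel_on_circle) (use N that in auto)
    then have "exp (- 2 * s) * (2 * pi * (\<Sum>k<Suc (Suc n). (norm (c k))\<^sup>2 * exp s ^ (2 * k))) \<le> J s"
      unfolding J_def nd by simp
    moreover have "j s = exp (- 2 * s) * (2 * pi * (\<Sum>k<Suc (Suc n). (norm (c k))\<^sup>2 * exp s ^ (2 * k)))"
    proof -
      have x: "exp (- 2 * s) * exp s ^ 2 = 1" by (simp flip: exp_of_nat_mult exp_add)
      have coeff: "exp (- 2 * s) * ((norm (c (Suc (Suc k))))\<^sup>2 * exp s ^ (2 * Suc (Suc k)))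
          = (real (Suc k))\<^sup>2 * (norm (b (Suc k)))\<^sup>2 * exp s ^ (2 * k + 2)" for k
      proof -
        have "exp (- 2 * s) * ((norm (c (Suc (Suc k))))\<^sup>2 * exp s ^ (2 * Suc (Suc k)))
          = (exp (- 2 * s) * exp s ^ 2) * ((norm (c (Suc (Suc k))))\<^sup>2 * exp s ^ (2 * k + 2))"
          by (simp add: power_add power2_eq_square mult_ac)
        also have "\<dots> = (norm (c (Suc (Suc k))))\<^sup>2 * exp s ^ (2 * k + 2)" by (simp only: x mult_1)
        also have "\<dots> = (real (Suc k))\<^sup>2 * (norm (b (Suc k)))\<^sup>2 * exp s ^ (2 * k + 2)"
          by (simp add: c_def norm_mult power_mult_distrib del: of_nat_Suc)
        finally show ?thesis .
      qed
      have "(\<Sum>k<Suc (Suc n). (norm (c k))\<^sup>2 * exp s ^ (2 * k))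
          = 1 + (\<Sum>k<n. (norm (c (Suc (Suc k))))\<^sup>2 * exp s ^ (2 * Suc (Suc k)))"
        by (simp add: sum.lessThan_Suc_shift c_def del: sum.lessThan_Suc)
      then have "exp (- 2 * s) * (\<Sum>k<Suc (Suc n). (norm (c k))\<^sup>2 * exp s ^ (2 * k))
          = exp (- 2 * s) + (\<Sum>k<n. (real (Suc k))\<^sup>2 * (norm (b (Suc k)))\<^sup>2 * exp s ^ (2 * k + 2))"
        by (simp only: distrib_left sum_distrib_left coeff mult_1_right)
      then show ?thesis unfolding j_def by (simp only: mult.left_commute)
    qed
    ultimately show ?thesis by simp
  qed
  let ?P = "\<lambda>s. pi * (- exp (- 2 * s) + polynomial_area b n (exp s))"
  have "(j has_integral ?P s1 - ?P s0) {s0..s1}"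
  proof (rule fundamental_theorem_of_calculus[OF s(1)])
    fix s assume "s \<in> {s0..s1}"
    have pw: "((\<lambda>s. exp s ^ m) has_real_derivative real m * exp s ^ m) (at s)" for m and s :: real
      unfolding exp_of_nat_mult[symmetric] by (auto intro!: derivative_eq_intros)
    have "((\<lambda>s. polynomial_area b n (exp s)) has_real_derivative
        (\<Sum>k<n. real (Suc k) * (norm (b (Suc k)))\<^sup>2 * (real (2 * k + 2) * exp s ^ (2 * k + 2)))) (at s)"
      unfolding polynomial_area_def by (intro DERIV_sum DERIV_cmult pw)
    then have "(?P has_real_derivative pi * (2 * exp (- 2 * s) +
        (\<Sum>k<n. real (Suc k) * (norm (b (Suc k)))\<^sup>2 * (real (2 * k + 2) * exp s ^ (2 * k + 2))))) (at s)"
      by (auto intro!: derivative_eq_intros)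
    also have "pi * (2 * exp (- 2 * s) +
        (\<Sum>k<n. real (Suc k) * (norm (b (Suc k)))\<^sup>2 * (real (2 * k + 2) * exp s ^ (2 * k + 2)))) = j s"
    proof -
      have "real (Suc k) * (norm (b (Suc k)))\<^sup>2 * (real (2 * k + 2) * exp s ^ (2 * k + 2))
          = 2 * ((real (Suc k))\<^sup>2 * (norm (b (Suc k)))\<^sup>2 * exp s ^ (2 * k + 2))" for k
        by (simp add: power2_eq_square algebra_simps)
      then show ?thesis unfolding j_def by (simp only: flip: sum_distrib_left) (simp add: algebra_simps)
    qed
    finally show "(?P has_vector_derivative j s) (at s within {s0..s1})"
      by (simp add: has_real_derivative_iff_has_vector_derivative has_vector_derivative_at_within)
  qed
  moreover have "(J has_integral integral {s0..s1} J) {s0..s1}"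
  proof -
    have "continuous_on ({s0..s1} \<times> cbox 0 (2*pi)) (\<lambda>(s, t). (norm (deriv K (Complex s t)))\<^sup>2)"
      unfolding case_prod_beta
      by (intro continuous_intros continuous_on_compose2[OF holomorphic_on_imp_continuous_on[OF holomorphic_deriv[OF holK opn]]])
         (use s in \<open>auto intro!: continuous_intros simp: Complex_eq\<close>)
    from integral_continuous_on_param[OF this] have "continuous_on {s0..s1} J"
      by (simp add: J_def)
    then show ?thesis by (intro integrable_integral integrable_continuous_real)
  qed
  ultimately have "?P s1 - ?P s0 \<le> integral {s0..s1} J"
    by (rule has_integral_le) (use s jJ in auto)
  then show "pi * (exp (- 2 * s0) - exp (- 2 * s1) + polynomial_area b n (exp s1) - polynomial_area b n (exp s0))
     \<le> integral {s0..s1} (\<lambda>s. integral {0..2*pi} (\<lambda>t. (norm (deriv K (Complex s t)))\<^sup>2))"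
    by (simp add: J_def[abs_def] algebra_simps)
qed

lemma inj_on_exp_strip: "inj_on exp {\<zeta>. 0 < Im \<zeta> \<and> Im \<zeta> < 2 * pi}"
proof (rule inj_onI, clarsimp)
  fix x y assume xy: "0 < Im x" "Im x < 2 * pi" "0 < Im y" "Im y < 2 * pi" "exp x = exp y"
  then obtain m :: int where m: "x = y + of_int (2 * m) * of_real pi * \<i>" by (auto simp: exp_eq)
  then have eq: "Im x = Im y + 2 * of_int m * pi" by simp
  have "2 * (of_int m * pi) < 2 * (1 * pi)" "2 * (- 1 * pi) < 2 * (of_int m * pi)" using eq xy by linarith+
  then have "of_int m < (1::real)" "- 1 < (of_int m :: real)"
    by (simp_all only: mult_less_cancel_left_pos mult_less_cancel_right_pos pi_gt_zero zero_less_numeral)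
  then have "m = 0" by linarith
  with m show "x = y" by simp
qed

text \<open>
  Gronwall's area theorem: the injective image of an annulus cannot have a larger area than the ellipse
  enclosing it. The divergent parts \<open>\<pi>\<epsilon>\<^sup>-\<^sup>2\<close> of both areas cancel, which leaves the inequality \<open>key\<close>,
  in which \<open>\<epsilon> \<rightarrow> 0\<close> and \<open>r \<rightarrow> 1\<close> can be taken.
\<close>

theorem area_theorem:
  fixes b :: "nat \<Rightarrow> complex"
  assumes h: "\<And>z. norm z < 1 \<Longrightarrow> (\<lambda>n. b n * z ^ n) sums h z"
    and inj: "inj_on (\<lambda>z. 1 / z + h z) (ball 0 1 - {0})"
  shows "(\<Sum>k<n. real (Suc k) * (norm (b (Suc k)))\<^sup>2) \<le> 1"
proof -
  \<comment> \<open>a translation of the image changes neither injectivity nor area, so assume \<open>b\<^sub>0 = 0\<close>\<close>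
  define h0 where "h0 z = h z - b 0" for z
  define b0 where "b0 = b(0 := 0)"
  have h0: "(\<lambda>n. b0 n * z ^ n) sums h0 z" if "norm z < 1" for z
  proof -
    have "(\<lambda>n. b0 (Suc n) * z ^ Suc n) sums (h z - b 0 * z ^ 0)"
      using sums_Suc_iff[of "\<lambda>n. b n * z ^ n" "h z - b 0 * z ^ 0"] h[OF that] by (simp add: b0_def)
    then show ?thesis using sums_Suc_iff[of "\<lambda>n. b0 n * z ^ n" "h0 z"] by (simp add: h0_def b0_def)
  qed
  have inj0: "inj_on (\<lambda>z. 1 / z + h0 z) (ball 0 1 - {0})"
    using inj by (simp add: inj_on_def h0_def)
  have b00: "b0 0 = 0" by (simp add: b0_def)
  obtain C \<delta> where C: "C \<ge> 0" "0 < \<delta>" "\<delta> < 1"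
    and small: "\<And>\<epsilon>. 0 < \<epsilon> \<Longrightarrow> \<epsilon> < \<delta> \<Longrightarrow> norm (b0 1) \<le> 1 / \<epsilon>\<^sup>2"
    and encl: "\<And>\<epsilon> z. 0 < \<epsilon> \<Longrightarrow> \<epsilon> < \<delta> \<Longrightarrow> \<epsilon> \<le> norm z \<Longrightarrow> norm z < 1 \<Longrightarrow>
       1 / z + h0 z \<in> (\<lambda>v. b0 1 * v + of_real (1 / \<epsilon>\<^sup>2) * cnj v) ` cball 0 (\<epsilon> + C * \<epsilon> ^ 4)"
    using image_enclosed_by_ellipse[OF h0 b00 inj0] by blast
  let ?A = "polynomial_area b0 n"
  have key: "?A r - ?A \<epsilon> \<le> 1 / r\<^sup>2 + 2 * C * \<epsilon> + C\<^sup>2 * \<epsilon> ^ 4"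
    if e: "0 < \<epsilon>" "\<epsilon> < \<delta>" and r: "\<epsilon> < r" "r < 1" for \<epsilon> r
  proof -
    define s0 s1 where "s0 = ln \<epsilon>" and "s1 = ln r"
    have s: "s0 \<le> s1" "s1 < 0" "exp s0 = \<epsilon>" "exp s1 = r" using e r by (auto simp: s0_def s1_def)
    have e2: "exp (- 2 * s0) = 1 / \<epsilon>\<^sup>2" "exp (- 2 * s1) = 1 / r\<^sup>2"
      by (simp_all add: exp_minus inverse_eq_divide exp_double s)
    define K where "K = (\<lambda>\<zeta>. exp (- \<zeta>) + h0 (exp \<zeta>))"
    have area: "pi * (exp (- 2 * s0) - exp (- 2 * s1) + ?A (exp s1) - ?A (exp s0))
        \<le> integral {s0..s1} (\<lambda>s. integral {0..2*pi} (\<lambda>t. (norm (deriv K (Complex s t)))\<^sup>2))"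
      "K holomorphic_on {\<zeta>. Re \<zeta> < 0}"
      unfolding K_def by (rule area_in_log_coordinates[where b = b0, OF _ s(1,2)]; use h0 in blast)+
    let ?p = "Complex s0 0" and ?q = "Complex s1 (2 * pi)"
    let ?E = "(\<lambda>v. b0 1 * v + of_real (1 / \<epsilon>\<^sup>2) * cnj v) ` cball 0 (\<epsilon> + C * \<epsilon> ^ 4)"
    have Kexp: "K \<zeta> = 1 / exp \<zeta> + h0 (exp \<zeta>)" for \<zeta>
      by (simp add: K_def exp_minus inverse_eq_divide)
    have injK: "inj_on K (box ?p ?q)"
    proof -
      have "inj_on exp (box ?p ?q)"
        by (rule inj_on_subset[OF inj_on_exp_strip]) (auto simp: in_box_complex_iff)
      moreover have "inj_on (\<lambda>z. 1 / z + h0 z) (exp ` box ?p ?q)"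
        by (rule inj_on_subset[OF inj0]) (use s in \<open>auto simp: in_box_complex_iff\<close>)
      ultimately show ?thesis using comp_inj_on[of exp "box ?p ?q" "\<lambda>z. 1 / z + h0 z"]
        by (simp add: o_def Kexp[abs_def])
    qed
    have sub: "cbox ?p ?q \<subseteq> {\<zeta>. Re \<zeta> < 0}" using s by (auto simp: in_cbox_complex_iff)
    note m = measure_holomorphic_image_box[OF area(2) open_halfspace_Re_lt sub injK]
    have "K ` box ?p ?q \<subseteq> ?E"
    proof clarify
      fix \<zeta> assume z: "\<zeta> \<in> box ?p ?q"
      then have "\<epsilon> \<le> exp (Re \<zeta>)" "Re \<zeta> < 0" using s by (auto simp: in_box_complex_iff simp flip: s(3))
      then show "K \<zeta> \<in> ?E" unfolding Kexp by (intro encl e) auto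
    qed
    then have "measure lebesgue (vec_of_complex ` K ` box ?p ?q) \<le> measure lebesgue (vec_of_complex ` ?E)"
      by (intro measure_mono_fmeasurable image_mono fmeasurableD m(2) measure_planar_linear_image_cball(2))
         (use e C in auto)
    also have "\<dots> = \<bar>(norm (b0 1))\<^sup>2 - (1 / \<epsilon>\<^sup>2)\<^sup>2\<bar> * (pi * (\<epsilon> + C * \<epsilon> ^ 4)\<^sup>2)"
      using e C by (subst measure_planar_linear_image_cball(1)) (auto simp: norm_divide norm_power)
    also have "\<dots> \<le> (1 / \<epsilon>\<^sup>2)\<^sup>2 * (pi * (\<epsilon> + C * \<epsilon> ^ 4)\<^sup>2)"
    proof (intro mult_right_mono)
      have "(norm (b0 1))\<^sup>2 \<le> (1 / \<epsilon>\<^sup>2)\<^sup>2" using small[OF e] by (intro power_mono) auto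
      then show "\<bar>(norm (b0 1))\<^sup>2 - (1 / \<epsilon>\<^sup>2)\<^sup>2\<bar> \<le> (1 / \<epsilon>\<^sup>2)\<^sup>2"
        unfolding abs_le_iff using zero_le_power2[of "norm (b0 1)"] zero_le_power2[of "1 / \<epsilon>\<^sup>2"] by linarith
    qed simp
    also have "\<dots> = pi * (1 / \<epsilon>\<^sup>2 + 2 * C * \<epsilon> + C\<^sup>2 * \<epsilon> ^ 4)"
      using e by (simp add: field_simps power2_eq_square power_numeral_reduce)
    finally have "pi * (1 / \<epsilon>\<^sup>2 - 1 / r\<^sup>2 + ?A r - ?A \<epsilon>) \<le> pi * (1 / \<epsilon>\<^sup>2 + 2 * C * \<epsilon> + C\<^sup>2 * \<epsilon> ^ 4)"
      using m(1) area(1) unfolding e2 s complex.sel by linarith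
    then show ?thesis by (simp only: mult_le_cancel_left_pos pi_gt_zero)
  qed
  have tA: "(?A \<longlongrightarrow> ?A x) (at x within S)" for x S
    unfolding polynomial_area_def by (intro tendsto_intros)
  have Ar: "?A r \<le> 1 / r\<^sup>2" if r: "0 < r" "r < 1" for r
  proof (rule tendsto_le)
    show "((\<lambda>\<epsilon>. ?A r - ?A \<epsilon>) \<longlongrightarrow> ?A r) (at_right 0)"
      by (rule tendsto_eq_intros tA refl)+ (simp add: polynomial_area_def)
    show "((\<lambda>\<epsilon>. 1 / r\<^sup>2 + 2 * C * \<epsilon> + C\<^sup>2 * \<epsilon> ^ 4) \<longlongrightarrow> 1 / r\<^sup>2) (at_right 0)"
      by (auto intro!: tendsto_eq_intros)
    have "eventually (\<lambda>\<epsilon>. \<epsilon> \<in> {0<..<min \<delta> r}) (at_right (0::real))"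
      by (rule eventually_at_right_real) (use C r in auto)
    then show "eventually (\<lambda>\<epsilon>. ?A r - ?A \<epsilon> \<le> 1 / r\<^sup>2 + 2 * C * \<epsilon> + C\<^sup>2 * \<epsilon> ^ 4) (at_right 0)"
      by eventually_elim (use key r in auto)
  qed simp
  have "?A 1 \<le> 1"
  proof (rule tendsto_le)
    show "(?A \<longlongrightarrow> ?A 1) (at_left 1)" by (rule tA)
    show "((\<lambda>r. 1 / r\<^sup>2) \<longlongrightarrow> (1::real)) (at_left 1)"
      by (auto intro!: tendsto_eq_intros)
    have "eventually (\<lambda>r. r \<in> {0<..<1}) (at_left (1::real))"
      by (rule eventually_at_left_real) simp
    then show "eventually (\<lambda>r. ?A r \<le> 1 / r\<^sup>2) (at_left 1)"
      by eventually_elim (use Ar in auto)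
  qed simp
  then show ?thesis by (simp add: polynomial_area_def b0_def)
qed

section \<open>Coefficients of univalent functions\<close>

text \<open>
  With \<open>\<psi> = \<phi>\<^sup>-\<^sup>1\<^sup>/\<^sup>2\<close>, the function \<open>G(z) = \<psi>(z\<^sup>2)/z\<close> satisfies \<open>G(z)\<^sup>2 f(z\<^sup>2) = 1\<close>. If \<open>G(z) = G(w)\<close>, then
  \<open>z\<^sup>2 = w\<^sup>2\<close> by injectivity of \<open>f\<close>, and \<open>z = -w\<close> is excluded because \<open>G\<close> is odd without zeros.
  The coefficient of \<open>z\<^sup>2\<^sup>k\<^sup>-\<^sup>1\<close> in \<open>G\<close> is that of \<open>w\<^sup>k\<close> in \<open>\<psi>\<close>, which gives the weights \<open>1, 3, 5\<close>.
\<close>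

lemma area_theorem_square_root_transform:
  fixes f \<phi> \<psi> :: "complex \<Rightarrow> complex" and B :: "nat \<Rightarrow> complex"
  assumes inj: "inj_on f (ball 0 1)"
    and f: "\<And>z. norm z < 1 \<Longrightarrow> f z = z * \<phi> z"
    and \<psi>\<phi>: "\<And>z. norm z < 1 \<Longrightarrow> \<psi> z * \<psi> z * \<phi> z = 1"
    and B: "\<And>z. norm z < 1 \<Longrightarrow> (\<lambda>n. B n * z ^ n) sums \<psi> z"
    and B0: "B 0 = 1"
  shows "(norm (B 1))\<^sup>2 + 3 * (norm (B 2))\<^sup>2 + 5 * (norm (B 3))\<^sup>2 \<le> 1"
proof -
  obtain \<psi>1 where \<psi>1: "\<And>z. norm z < 1 \<Longrightarrow> (\<lambda>n. B (Suc n) * z ^ n) sums \<psi>1 z"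
    and \<psi>: "\<And>z. norm z < 1 \<Longrightarrow> \<psi> z = B 0 + z * \<psi>1 z"
    using power_series_tail[of B \<psi>, OF B] by blast
  define h where "h z = z * \<psi>1 (z\<^sup>2)" for z
  define b where "b n = (if odd n then B (Suc n div 2) else 0)" for n
  have sq: "norm (z\<^sup>2) < 1" if "norm z < 1" for z :: complex
    using that by (simp add: norm_power power_less_one_iff)
  have h: "(\<lambda>n. b n * z ^ n) sums h z" if "norm z < 1" for z
  proof -
    have "(\<lambda>k. z * (B (Suc k) * (z\<^sup>2) ^ k)) sums h z"
      unfolding h_def by (intro sums_mult \<psi>1 sq that)
    also have "(\<lambda>k. z * (B (Suc k) * (z\<^sup>2) ^ k)) = (\<lambda>k. b (2 * k + 1) * z ^ (2 * k + 1))"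
      by (simp add: b_def power_mult fun_eq_iff)
    finally show ?thesis
    proof (subst (asm) sums_mono_reindex)
      show "strict_mono (\<lambda>k::nat. 2 * k + 1)" by (simp add: strict_mono_def)
      show "b n * z ^ n = 0" if "n \<notin> range (\<lambda>k. 2 * k + 1)" for n
        using that by (auto simp: b_def elim!: oddE)
    qed
  qed
  let ?G = "\<lambda>z. 1 / z + h z"
  have G: "?G z = \<psi> (z\<^sup>2) / z" if "norm z < 1" "z \<noteq> 0" for z
    using \<psi>[OF sq[OF that(1)]] that by (simp add: h_def B0 field_simps power2_eq_square)
  have Gsq: "(?G z)\<^sup>2 * f (z\<^sup>2) = 1" if "norm z < 1" "z \<noteq> 0" for z
    unfolding G[OF that] f[OF sq[OF that(1)]] using \<psi>\<phi>[OF sq[OF that(1)]] that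
    by (simp add: power2_eq_square mult.assoc)
  have "inj_on ?G (ball 0 1 - {0})"
  proof (rule inj_onI)
    fix z w assume "z \<in> ball 0 1 - {0}" "w \<in> ball 0 1 - {0}" and eq: "?G z = ?G w"
    then have zw: "norm z < 1" "z \<noteq> 0" "norm w < 1" "w \<noteq> 0" by auto
    have Gw: "?G w \<noteq> 0" using Gsq[OF zw(3,4)] by auto
    have "(?G w)\<^sup>2 * f (z\<^sup>2) = (?G w)\<^sup>2 * f (w\<^sup>2)"
      using Gsq[OF zw(1,2)] Gsq[OF zw(3,4)] unfolding eq by simp
    then have "f (z\<^sup>2) = f (w\<^sup>2)" using Gw by simp
    then have "z\<^sup>2 = w\<^sup>2" using inj_onD[OF inj] sq zw by auto
    moreover have "z \<noteq> - w"
    proof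
      assume "z = - w"
      then have "?G z = - ?G w" by (simp add: h_def)
      moreover have "v = 0" if "v = - v" for v :: complex using that by (simp add: complex_eq_iff)
      ultimately show False using eq Gw by metis
    qed
    ultimately show "z = w" by (simp add: power2_eq_iff)
  qed
  from area_theorem[OF h this, of 5]
  have "(\<Sum>k<5. real (Suc k) * (norm (b (Suc k)))\<^sup>2) \<le> 1" .
  moreover have "b (Suc 0) = B 1" "b (Suc (Suc 0)) = 0" "b 3 = B 2" "b 4 = 0" "b 5 = B 3"
    by (simp_all add: b_def)
  moreover have "(\<Sum>k<5. F k) = F 0 + F 1 + F 2 + F 3 + F 4" for F :: "nat \<Rightarrow> real"
    by (simp add: eval_nat_numeral)
  ultimately show ?thesis by simp
qed

text \<open>
  The \<open>B\<^sub>n\<close> are the Taylor coefficients of \<open>(w / f(w))\<^sup>1\<^sup>/\<^sup>2\<close>; the formulas for \<open>a\<^sub>3\<close> and \<open>a\<^sub>4\<close> are the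
  expansion of \<open>f(w) / w = (1 + B\<^sub>1 w + B\<^sub>2 w\<^sup>2 + B\<^sub>3 w\<^sup>3 + \<dots>)\<^sup>-\<^sup>2\<close>.
\<close>

lemma class_S_inverse_square_root:
  assumes f: "f \<in> class_S"
    and a: "\<And>z. norm z < 1 \<Longrightarrow> (\<lambda>n. a (n + 2) * z ^ (n + 2)) sums (f z - z)"
  obtains B :: "nat \<Rightarrow> complex"
    where "(norm (B 1))\<^sup>2 + 3 * (norm (B 2))\<^sup>2 + 5 * (norm (B 3))\<^sup>2 \<le> 1"
      and "a 3 = 3 * (B 1)\<^sup>2 - 2 * B 2"
      and "a 4 = 6 * B 1 * B 2 - 4 * B 1 ^ 3 - 2 * B 3"
proof -
  have f0: "f 0 = 0" and inj: "inj_on f (ball 0 1)" using f by (auto simp: class_S_def)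
  define d where "d n = (if n = 0 then 0 else if n = 1 then 1 else a n)" for n
  have "(\<lambda>n. d n * z ^ n) sums f z" if "norm z < 1" for z
  proof -
    have "(\<lambda>n. d (Suc (Suc n)) * z ^ Suc (Suc n)) sums (f z - z)"
      using a[OF that] by (simp add: d_def)
    then have "(\<lambda>n. d (Suc n) * z ^ Suc n) sums (f z - z + d (Suc 0) * z ^ Suc 0)" by (rule sums_Suc)
    then have "(\<lambda>n. d n * z ^ n) sums (f z - z + d (Suc 0) * z ^ Suc 0 + d 0 * z ^ 0)" by (rule sums_Suc)
    then show ?thesis by (simp add: d_def)
  qed
  from power_series_tail[of d f, OF this]
  obtain \<phi> where \<phi>: "\<And>z. norm z < 1 \<Longrightarrow> (\<lambda>n. d (Suc n) * z ^ n) sums \<phi> z"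
    and f\<phi>: "\<And>z. norm z < 1 \<Longrightarrow> f z = z * \<phi> z"
    by (auto simp: d_def)
  have \<phi>0: "\<phi> 0 = 1"
    using \<phi>[of 0] by (simp add: d_def)
  have \<phi>nz: "\<phi> z \<noteq> 0" if "norm z < 1" for z
  proof
    assume "\<phi> z = 0"
    then have "f z = f 0" using f\<phi>[OF that] f0 by simp
    then have "z = 0" using inj_onD[OF inj, of z 0] that by simp
    then show False using \<phi>0 \<open>\<phi> z = 0\<close> by simp
  qed
  have hol\<phi>: "\<phi> holomorphic_on ball 0 1" using \<phi> by (rule power_series_unit_disc_holomorphic)
  obtain g where g: "g holomorphic_on ball 0 1" "\<And>z. z \<in> ball 0 1 \<Longrightarrow> exp (g z) = \<phi> z"
    using holomorphic_logarithm_exists[of "ball 0 1" \<phi> 0] hol\<phi> \<phi>nz by auto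
  \<comment> \<open>subtracting \<open>g 0\<close> selects the branch with \<open>\<psi> 0 = 1\<close>\<close>
  define \<psi> where "\<psi> z = exp (- (g z - g 0) / 2)" for z
  have hol\<psi>: "\<psi> holomorphic_on ball 0 1" unfolding \<psi>_def by (intro holomorphic_intros g) auto
  have \<psi>\<phi>: "\<psi> z * \<psi> z * \<phi> z = 1" if "norm z < 1" for z
  proof -
    have "\<psi> z * \<psi> z = exp (- (g z - g 0) / 2 + - (g z - g 0) / 2)" by (simp only: \<psi>_def exp_add)
    also have "- (g z - g 0) / 2 + - (g z - g 0) / 2 = g 0 - g z" by simp
    finally have "\<psi> z * \<psi> z = exp (g 0) / exp (g z)" by (simp only: exp_diff)
    then show ?thesis using g(2)[of 0] g(2)[of z] \<phi>0 \<phi>nz that by simp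
  qed
  define B where "B n = (deriv ^^ n) \<psi> 0 / fact n" for n
  have B: "(\<lambda>n. B n * z ^ n) sums \<psi> z" if "norm z < 1" for z
    using holomorphic_power_series[OF hol\<psi>, of z] that by (simp add: B_def)
  have B0: "B 0 = 1" by (simp add: B_def \<psi>_def)
  have small: "eventually (\<lambda>z::complex. norm z < 1) (nhds 0)"
    using eventually_nhds_in_open[of "ball (0::complex) 1" 0] by simp
  have X: "\<psi> has_fps_expansion Abs_fps B"
    using eventually_mono[OF small B] by (intro has_fps_expansionI) simp
  have P: "\<phi> has_fps_expansion Abs_fps (\<lambda>n. d (Suc n))"
    using eventually_mono[OF small \<phi>] by (intro has_fps_expansionI) simp
  have "eventually (\<lambda>z. \<psi> z * \<psi> z * \<phi> z = 1) (nhds 0)"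
    using small by eventually_elim (rule \<psi>\<phi>)
  then have "(\<lambda>z. \<psi> z * \<psi> z * \<phi> z) has_fps_expansion 1"
    using has_fps_expansion_cong[OF _ refl, of "\<lambda>z. \<psi> z * \<psi> z * \<phi> z" "\<lambda>_. 1" 1] has_fps_expansion_1
    by simp
  then have prod: "Abs_fps B * Abs_fps B * Abs_fps (\<lambda>n. d (Suc n)) = 1"
    by (rule fps_expansion_unique_complex[OF has_fps_expansion_mult[OF has_fps_expansion_mult[OF X X] P]])
  have e1: "d 2 + 2 * B 1 = 0"
    using arg_cong[OF prod, of "\<lambda>F. fps_nth F 1"]
    by (simp add: fps_mult_nth B0 d_def numeral_eq_Suc algebra_simps)
  have e2: "a 3 + 2 * B 1 * d 2 + 2 * B 2 + B 1 * B 1 = 0"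
    using arg_cong[OF prod, of "\<lambda>F. fps_nth F 2"]
    by (simp add: fps_mult_nth B0 d_def numeral_eq_Suc algebra_simps)
  have e3: "a 4 + 2 * B 1 * a 3 + (2 * B 2 + B 1 * B 1) * d 2 + 2 * B 3 + 2 * B 1 * B 2 = 0"
    using arg_cong[OF prod, of "\<lambda>F. fps_nth F 3"]
    by (simp add: fps_mult_nth B0 d_def numeral_eq_Suc algebra_simps)
  show thesis
  proof
    show "(norm (B 1))\<^sup>2 + 3 * (norm (B 2))\<^sup>2 + 5 * (norm (B 3))\<^sup>2 \<le> 1"
      by (rule area_theorem_square_root_transform[OF inj f\<phi> \<psi>\<phi> B B0])
    have d2: "d 2 = - 2 * B 1" using e1 by (simp add: eq_neg_iff_add_eq_0)
    have "a 3 = - (2 * B 1 * d 2 + 2 * B 2 + B 1 * B 1)" using e2 by (simp only: eq_neg_iff_add_eq_0 add.assoc)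
    then show a3: "a 3 = 3 * (B 1)\<^sup>2 - 2 * B 2" by (simp add: d2 power2_eq_square algebra_simps)
    have "a 4 = - (2 * B 1 * a 3 + (2 * B 2 + B 1 * B 1) * d 2 + 2 * B 3 + 2 * B 1 * B 2)"
      using e3 by (simp only: eq_neg_iff_add_eq_0 add.assoc)
    then show "a 4 = 6 * B 1 * B 2 - 4 * B 1 ^ 3 - 2 * B 3"
      by (simp add: d2 a3 power2_eq_square power3_eq_cube algebra_simps)
  qed
qed

text \<open>
  Split \<open>4xy\<close> and \<open>2u\<close> by the arithmetic-geometric mean inequality and use \<open>x\<^sup>3 \<le> x\<^sup>2\<close>. The weight
  \<open>19/25\<close> of \<open>x\<^sup>2\<close> in the first split nearly solves \<open>3\<mu>(1 + \<mu>) = 4\<close>, the condition for the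
  totals of \<open>x\<^sup>2\<close> and \<open>y\<^sup>2\<close> to be in the ratio \<open>1 : 3\<close> of the ellipsoid, with common factor
  \<open>1 + 19/25 = 44/25\<close>. Giving \<open>u\<^sup>2\<close> the weight \<open>5 * 44/25\<close> leaves the bound \<open>44/25 + 5/44 < 2.1\<close>.
\<close>

lemma coefficient_bound_on_ellipsoid:
  fixes x y u :: real
  assumes "0 \<le> x" "x\<^sup>2 + 3 * y\<^sup>2 + 5 * u\<^sup>2 \<le> 1"
  shows "2 * u + 4 * x * y + x ^ 3 \<le> 2.1"
proof -
  have "x\<^sup>2 \<le> 1" using assms(2) zero_le_power2[of y] zero_le_power2[of u] by linarith
  then have "x \<le> 1" by (simp add: abs_square_le_1)
  then have "x ^ 3 \<le> x\<^sup>2" using assms(1) by (intro power_decreasing) auto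
  moreover have "4 * x * y \<le> (19/25) * x\<^sup>2 + (132/25) * y\<^sup>2"
  proof -
    have "0 \<le> (19/25) * (x - (50/19) * y)\<^sup>2" by simp
    also have "\<dots> = (19/25) * x\<^sup>2 - 4 * x * y + (100/19) * y\<^sup>2" by (simp add: power2_eq_square algebra_simps)
    finally show ?thesis using zero_le_power2[of y] by linarith
  qed
  moreover have "2 * u \<le> (44/5) * u\<^sup>2 + 5/44"
  proof -
    have "0 \<le> (44/5) * (u - 5/44)\<^sup>2" by simp
    also have "\<dots> = (44/5) * u\<^sup>2 - 2 * u + 5/44" by (simp add: power2_eq_square algebra_simps)
    finally show ?thesis by simp
  qed
  ultimately show ?thesis using assms(2) by linarith
qed

theorem theorem3:
  fixes f :: "complex \<Rightarrow> complex" and a :: "nat \<Rightarrow> complex"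
  assumes "f \<in> class_S"
    and "\<And>z. norm z < 1 \<Longrightarrow> (\<lambda>n. a (n + 2) * z ^ (n + 2)) sums (f z - z)"
  shows "norm (a 4) - norm (a 3) \<le> (2.1033299 :: real)"
proof -
  obtain B :: "nat \<Rightarrow> complex" where area: "(norm (B 1))\<^sup>2 + 3 * (norm (B 2))\<^sup>2 + 5 * (norm (B 3))\<^sup>2 \<le> 1"
    and a3: "a 3 = 3 * (B 1)\<^sup>2 - 2 * B 2"
    and a4: "a 4 = 6 * B 1 * B 2 - 4 * B 1 ^ 3 - 2 * B 3"
    using class_S_inverse_square_root[OF assms] by blast
  \<comment> \<open>as \<open>\<bar>B\<^sub>1\<bar> \<le> 1\<close>, replacing \<open>\<bar>a\<^sub>3\<bar>\<close> by \<open>\<bar>B\<^sub>1 a\<^sub>3\<bar>\<close> only enlarges the difference; in \<open>a\<^sub>4 + B\<^sub>1 a\<^sub>3\<close> the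
     moduli of the coefficients of \<open>B\<^sub>1 B\<^sub>2\<close> and \<open>B\<^sub>1\<^sup>3\<close> drop from \<open>6\<close> to \<open>4\<close> and from \<open>4\<close> to \<open>1\<close>\<close>
  have "(norm (B 1))\<^sup>2 \<le> 1"
    using area zero_le_power2[of "norm (B 2)"] zero_le_power2[of "norm (B 3)"] by linarith
  then have "norm (B 1) \<le> 1" by (simp add: abs_square_le_1)
  then have "norm (a 4) - norm (a 3) \<le> norm (a 4) - norm (B 1 * a 3)"
    by (simp add: norm_mult mult_left_le_one_le)
  also have "\<dots> \<le> norm (a 4 + B 1 * a 3)" by (rule norm_diff_ineq)
  also have "a 4 + B 1 * a 3 = 4 * B 1 * B 2 - 2 * B 3 - B 1 ^ 3"
    by (simp add: a3 a4 power2_eq_square power3_eq_cube algebra_simps)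
  also have "norm \<dots> \<le> 2 * norm (B 3) + 4 * norm (B 1) * norm (B 2) + norm (B 1) ^ 3"
    using norm_triangle_ineq4[of "4 * B 1 * B 2 - 2 * B 3" "B 1 ^ 3"]
      norm_triangle_ineq4[of "4 * B 1 * B 2" "2 * B 3"]
    by (simp add: norm_mult norm_power)
  also have "\<dots> \<le> 2.1" using area by (intro coefficient_bound_on_ellipsoid) auto
  finally show ?thesis by simp
qed

end
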